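(* Let $\mathcal{U}_M\subset\mathcal{X}$ be an $M$-dimensional space satisfying the unisolvency condition $$\psi\in\mathcal{U}_M,\ \ \ell_m^o(\psi)=0,\ m=1,\ldots,M\iff\psi\equiv0,$$ let $\mathbf{y}=[y_1,\ldots,y_M]\in\mathbb{R}^M$ and $\xi>0$. Then the solution $(z_\xi^\star,\eta_\xi^\star)$ to $$\inf_{(z,\eta)\in\mathcal{Z}_N\times\mathcal{U}_M}\ \xi\|\eta\|^2+\frac1M\|\mathcal{L}_M(z+\eta)-\mathbf{y}\|_2^2$$ solves the problem $$(\ast)\qquad (z_\xi^\star,\eta_\xi^\star):={\rm arg}\inf_{(z,\eta)\in\mathcal{Z}_N\times\mathcal{X}}\ \xi\,|||\eta|||^2+\frac1M\|\mathcal{L}_M(z+\eta)-\mathbf{y}\|_2^2 .$$ If the inf-sup constant $$\beta_{N,M}=\inf_{z\in\mathcal{Z}_N\setminus\{0\}}\ \sup_{q\in\mathcal{U}_M\setminus\{0\}}\ \frac{((z,q))}{|||z|||\,|||q|||}$$ is strictly positive, then the solution $(z_\xi^\star,\eta_\xi^\star)$ to $(\ast)$ is unique, and solves the saddle-point problem $$\left\{\begin{array}{ll}2\xi((\eta_\xi^\star,q))+\dfrac2M\displaystyle\sum_{m=1}^M\big(\ell_m^o(z_\xi^\star+\eta_\xi^\star)-y_m\big)\,\ell_m^o(q)=0&\forall\,q\in\mathcal{U}_M;\\[3mm]((\eta_\xi^\star,p))=0&\forall\,p\in\mathcal{Z}_N.\end{array}\right.$$ Furthermore, the state estimate $u_\xi^\star=z_\xi^\star+\eta_\xi^\star$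 satisfies $$u_\xi^\star\in\mathcal{Z}_N\oplus\big(\mathcal{Z}_N^{\perp,|||\cdot|||}\cap\mathcal{U}_M\big)=\{z+\eta:\ z\in\mathcal{Z}_N,\ \eta\in\mathcal{U}_M,\ ((\eta,q))=0\ \ \forall q\in\mathcal{Z}_N\},$$ where $\mathcal{Z}_N^{\perp,|||\cdot|||}$ denotes the orthogonal complement of $\mathcal{Z}_N$ with respect to the $|||\cdot|||$ norm (i.e. with respect to $((\cdot,\cdot))$).
   Context: $\mathcal{X}$ is a real Hilbert space (of functions on a Lipschitz domain $\Omega\subset\mathbb{R}^d$) with inner product $(\cdot,\cdot)$ and induced norm $\|\cdot\|$. $\ell_1^o,\ldots,\ell_M^o\in\mathcal{X}'$ are continuous linear observation functionals and $\mathcal{L}_M(u)=[\ell_1^o(u),\ldots,\ell_M^o(u)]\in\mathbb{R}^M$. $\mathcal{Z}_N\subset\mathcal{X}$ is an $N$-dimensional linear subspace (background space). Given $\mathcal{U}_M$ satisfying the unisolvency condition, the interpolation operator $\mathcal{I}_M:\mathcal{X}\to\mathcal{U}_M$ is defined by $\ell_m^o(\mathcal{I}_M(u))=\ell_m^o(u)$ for all $u\in\mathcal{X}$ and $m=1,\ldots,M$. The inner product $((\cdot,\cdot))$ on $\mathcal{X}$ and its induced norm are $$((u,v))=(u-\mathcal{I}_M(u),v-\mathcal{I}_M(v))+(\mathcal{I}_M(u),\mathcal{I}_M(v)),\qquad|||u|||=\sqrt{((u,u))}.$$ *)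

theory Defs
  imports "HOL-Analysis.Analysis"
begin

text \<open>
  The number \<open>M\<close> of observations is the cardinality of the finite index type \<open>'m\<close>, hence
  \<open>M \<ge> 1\<close>; vectors of observations live in \<open>real ^ 'm\<close>, whose \<open>norm\<close> is the Euclidean one.
  The ambient Hilbert space is a type of class \<open>real_inner\<close> and \<open>complete_space\<close>.
\<close>

text \<open>The constant \<open>dim\<close> is \<open>0\<close> on infinite-dimensional spaces, so finite generation is required
  separately.\<close>

definition n_dim_subspace :: "nat \<Rightarrow> 'a::real_vector set \<Rightarrow> bool" where
  "n_dim_subspace n V \<longleftrightarrow> subspace V \<and> (\<exists>B. finite B \<and> span B = V) \<and> dim V = n"

definition observe :: "('m::finite \<Rightarrow> 'a \<Rightarrow> real) \<Rightarrow> 'a \<Rightarrow> real ^ 'm" where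
  "observe l u = (\<chi> m. l m u)"

definition unisolvent :: "('m::finite \<Rightarrow> 'a::real_vector \<Rightarrow> real) \<Rightarrow> 'a set \<Rightarrow> bool" where
  "unisolvent l U \<longleftrightarrow> (\<forall>\<psi>. (\<psi> \<in> U \<and> (\<forall>m. l m \<psi> = 0)) \<longleftrightarrow> \<psi> = 0)"

text \<open>Meaningful if \<open>U\<close> is unisolvent and of dimension \<open>M\<close>: then the interpolant exists and is
  unique.\<close>

definition interpolant :: "('m::finite \<Rightarrow> 'a::real_vector \<Rightarrow> real) \<Rightarrow> 'a set \<Rightarrow> 'a \<Rightarrow> 'a" where
  "interpolant l U u = (THE v. v \<in> U \<and> (\<forall>m. l m v = l m u))"

text \<open>The modified inner product \<open>((u, v))\<close> and its norm \<open>|||u|||\<close>.\<close>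

definition minner :: "('m::finite \<Rightarrow> 'a::real_inner \<Rightarrow> real) \<Rightarrow> 'a set \<Rightarrow> 'a \<Rightarrow> 'a \<Rightarrow> real" where
  "minner l U u v =
     inner (u - interpolant l U u) (v - interpolant l U v)
     + inner (interpolant l U u) (interpolant l U v)"

definition mnorm :: "('m::finite \<Rightarrow> 'a::real_inner \<Rightarrow> real) \<Rightarrow> 'a set \<Rightarrow> 'a \<Rightarrow> real" where
  "mnorm l U u = sqrt (minner l U u u)"

text \<open>The penalised least-squares functional; \<open>\<nu>\<close> is the norm used in the penalty on \<open>\<eta>\<close>.\<close>

definition objective ::
  "('a::real_vector \<Rightarrow> real) \<Rightarrow> real \<Rightarrow> ('m::finite \<Rightarrow> 'a \<Rightarrow> real) \<Rightarrow> real ^ 'm \<Rightarrow> 'a \<times> 'a \<Rightarrow> real"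
where
  "objective \<nu> \<xi> l y =
     (\<lambda>(z, \<eta>). \<xi> * (\<nu> \<eta>)\<^sup>2 + 1 / real CARD('m) * (norm (observe l (z + \<eta>) - y))\<^sup>2)"

text \<open>Extended reals, so that the suprema and infima need no side conditions. In particular the
  constant is \<open>\<infinity>\<close> for \<open>Z = {0}\<close>.\<close>

definition inf_sup_const ::
  "('m::finite \<Rightarrow> 'a::real_inner \<Rightarrow> real) \<Rightarrow> 'a set \<Rightarrow> 'a set \<Rightarrow> ereal"
where
  "inf_sup_const l U Z =
     (INF z \<in> Z - {0}. SUP q \<in> U - {0}.
        ereal (minner l U z q / (mnorm l U z * mnorm l U q)))"

definition saddle_point ::
  "real \<Rightarrow> ('m::finite \<Rightarrow> 'a::real_inner \<Rightarrow> real) \<Rightarrow> real ^ 'm \<Rightarrow> 'a set \<Rightarrow> 'a set \<Rightarrow> 'a \<Rightarrow> 'a \<Rightarrow> bool"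
where
  "saddle_point \<xi> l y Z U z \<eta> \<longleftrightarrow>
     z \<in> Z \<and> \<eta> \<in> U \<and>
     (\<forall>q\<in>U. 2 * \<xi> * minner l U \<eta> q
        + 2 / real CARD('m) * (\<Sum>m\<in>UNIV. (l m (z + \<eta>) - y $ m) * l m q) = 0) \<and>
     (\<forall>p\<in>Z. minner l U \<eta> p = 0)"

definition morth_complement ::
  "('m::finite \<Rightarrow> 'a::real_inner \<Rightarrow> real) \<Rightarrow> 'a set \<Rightarrow> 'a set \<Rightarrow> 'a set"
where
  "morth_complement l U W = {v. \<forall>w\<in>W. minner l U v w = 0}"

definition is_direct_sum :: "'a::real_vector set \<Rightarrow> 'a set \<Rightarrow> 'a set \<Rightarrow> bool" where
  "is_direct_sum S V W \<longleftrightarrow>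
     subspace V \<and> subspace W \<and> V \<inter> W = {0} \<and> S = {v + w | v w. v \<in> V \<and> w \<in> W}"

end

theory Submission
  imports Defs
begin

text \<open>
  Interpolation splits every \<open>\<eta>\<close> into the components \<open>\<eta> - I \<eta>\<close> and \<open>I \<eta>\<close>. The data misfit sees
  only the second, and the penalty \<open>|||\<eta>|||\<close> charges for both, so replacing \<open>\<eta>\<close> by \<open>I \<eta>\<close> strictly
  lowers the functional unless \<open>\<eta> \<in> U\<close>; on \<open>U\<close> the two norms agree. Hence the problem over \<open>Z \<times> X\<close>
  has the same minimisers as the one over \<open>Z \<times> U\<close>. The latter is a finite-dimensional linear least
  squares problem, solved by orthogonal projection, and the saddle-point equations are its normal
  equations. Finally \<open>((z, q)) = (I z, q)\<close> for \<open>q \<in> U\<close>, so that the inf-sup condition forces \<open>I\<close> to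
  be injective on \<open>Z\<close>, which is what uniqueness needs.
\<close>

section \<open>Linear least squares\<close>

text \<open>Orthogonalise the spanning set; the projection of \<open>b\<close> is then its Fourier
  expansion along the orthogonal vectors.\<close>

lemma orthogonal_projection_exists:
  fixes B :: "'a::real_inner set"
  assumes "finite B"
  obtains p where "p \<in> span B" "\<And>s. s \<in> span B \<Longrightarrow> inner (p - b) s = 0"
proof -
  obtain C where C: "finite C" "span C = span B" "pairwise orthogonal C"
    using basis_orthogonal[OF assms] by blast
  define p where "p = (\<Sum>c\<in>C. (inner b c / inner c c) *\<^sub>R c)"
  have "p \<in> span C"
    unfolding p_def by (intro span_sum span_scale span_base)
  moreover have "inner (p - b) s = 0" if "s \<in> span C" for s
    using that
  proof (induction rule: span_induct)
    case base
    show ?case by (simp add: subspace_hyperplane)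
  next
    case (step d)
    \<comment> \<open>Orthogonality removes all terms but \<open>c = d\<close>. If
      \<open>d = 0\<close>, division by zero makes the coefficient 0, in agreement with
      \<open>inner b 0 = 0\<close>.\<close>
    have "inner p d = (\<Sum>c\<in>C. if c = d then inner b d else 0)"
      unfolding p_def inner_sum_left
      using C(3) step by (intro sum.cong) (auto simp: pairwise_def orthogonal_def)
    also have "\<dots> = inner b d"
      using C(1) step by simp
    finally show ?case by (simp add: inner_diff_left)
  qed
  ultimately show thesis
    using that C(2) by auto
qed

context
  fixes A :: "'a::real_vector \<Rightarrow> 'b::real_inner" and B :: "'a set" and b :: 'b
  assumes linear: "linear A" and finite: "finite B"
begin

lemma normal_equations_solvable:
  obtains x where "x \<in> span B" "\<And>v. v \<in> span B \<Longrightarrow> inner (A x - b) (A v) = 0"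
proof -
  obtain p where "p \<in> span (A ` B)" "\<And>s. s \<in> span (A ` B) \<Longrightarrow> inner (p - b) s = 0"
    using orthogonal_projection_exists[of "A ` B" b] finite by blast
  then show thesis
    using that unfolding linear_span_image[OF linear] by auto
qed

lemma least_squares_pythagoras:
  assumes "\<And>v. v \<in> span B \<Longrightarrow> inner (A x - b) (A v) = 0" "x \<in> span B" "w \<in> span B"
  shows "(norm (A w - b))\<^sup>2 = (norm (A x - b))\<^sup>2 + (norm (A w - A x))\<^sup>2"
proof -
  have "inner (A x - b) (A w - A x) = 0"
    using assms(1)[of "w - x"] assms(2,3) by (simp add: linear_diff[OF linear] span_diff)
  then have "(norm ((A x - b) + (A w - A x)))\<^sup>2 = (norm (A x - b))\<^sup>2 + (norm (A w - A x))\<^sup>2"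
    by (intro norm_add_Pythagorean) (simp add: orthogonal_def)
  then show ?thesis by simp
qed

text \<open>Pythagoras gives sufficiency. For necessity, compare the minimiser with some solution
  \<open>x0\<close> of the normal equations: the excess \<open>A x - A x0\<close> must vanish, so
  both have the same residual.\<close>

lemma least_squares_iff_normal_equations:
  "is_arg_min (\<lambda>x. (norm (A x - b))\<^sup>2) (\<lambda>x. x \<in> span B) x \<longleftrightarrow>
     x \<in> span B \<and> (\<forall>v\<in>span B. inner (A x - b) (A v) = 0)" (is "?min \<longleftrightarrow> ?normal")
proof
  assume ?min
  then have x: "x \<in> span B" "\<And>w. w \<in> span B \<Longrightarrow> (norm (A x - b))\<^sup>2 \<le> (norm (A w - b))\<^sup>2"
    by (auto simp: is_arg_min_def not_less)
  obtain x0 where x0: "x0 \<in> span B" "\<And>v. v \<in> span B \<Longrightarrow> inner (A x0 - b) (A v) = 0"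
    using normal_equations_solvable by blast
  have "(norm (A x - A x0))\<^sup>2 \<le> 0"
    using least_squares_pythagoras[OF x0(2,1) x(1)] x(2)[OF x0(1)] by simp
  then have "A x = A x0" by simp
  with x0 x show ?normal by simp
next
  assume n: ?normal
  then have "(norm (A x - b))\<^sup>2 \<le> (norm (A w - b))\<^sup>2" if "w \<in> span B" for w
    using least_squares_pythagoras[of x w] that by simp
  with n show ?min by (auto simp: is_arg_min_def not_less)
qed

text \<open>As \<open>A\<close> may have a kernel, only the images are determined; the excess in
  Pythagoras vanishes because both values are minimal.\<close>

lemma least_squares_unique_image:
  assumes "is_arg_min (\<lambda>x. (norm (A x - b))\<^sup>2) (\<lambda>x. x \<in> span B) x"
    and "is_arg_min (\<lambda>x. (norm (A x - b))\<^sup>2) (\<lambda>x. x \<in> span B) w"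
  shows "A x = A w"
proof -
  have n: "x \<in> span B" "w \<in> span B" "\<And>v. v \<in> span B \<Longrightarrow> inner (A x - b) (A v) = 0"
    using assms unfolding least_squares_iff_normal_equations by auto
  have "(norm (A w - b))\<^sup>2 \<le> (norm (A x - b))\<^sup>2"
    using assms n by (auto simp: is_arg_min_def not_less)
  then have "(norm (A w - A x))\<^sup>2 \<le> 0"
    using least_squares_pythagoras[OF n(3,1,2)] by simp
  then show ?thesis by simp
qed

end

text \<open>Brings a product of subspaces into the form \<open>span B\<close> in which the least
  squares lemmas are stated.\<close>

lemma Times_eq_span:
  "span B \<times> span C = span ((\<lambda>x. (x, 0)) ` B \<union> Pair 0 ` C)"
proof -
  have "linear (\<lambda>x::'a. (x, 0::'b))" "linear (Pair (0::'a) :: 'b \<Rightarrow> _)"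
    by (auto intro!: linearI)
  then show ?thesis
    by (force simp: span_Un linear_span_image)
qed

section \<open>Interpolation\<close>

locale unisolvent_observations =
  fixes l :: "'m::finite \<Rightarrow> 'a::real_inner \<Rightarrow> real" and U :: "'a set"
  assumes linear: "\<And>m. linear (l m)"
    and dimension: "n_dim_subspace CARD('m) U"
    and unisolvent: "unisolvent l U"
begin

lemma subspace_U: "subspace U"
  using dimension by (simp add: n_dim_subspace_def)

lemma linear_observe: "linear (observe l)"
  by (rule linearI)
    (simp_all add: observe_def vec_eq_iff linear_add[OF linear] linear_scale[OF linear])

lemma observe_eq_0_iff: "observe l v = 0 \<longleftrightarrow> v = 0" if "v \<in> U"
  using unisolvent that unfolding unisolvent_def by (auto simp: observe_def vec_eq_iff)

lemma inj_on_observe: "inj_on (observe l) U"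
proof (rule inj_onI)
  fix u v assume "u \<in> U" "v \<in> U" "observe l u = observe l v"
  then have "u - v = 0"
    using observe_eq_0_iff[of "u - v"] subspace_diff[OF subspace_U]
    by (simp add: linear_diff[OF linear_observe])
  then show "u = v" by simp
qed

text \<open>By injectivity a basis of \<open>U\<close> is mapped to \<open>CARD('m)\<close>
  independent vectors, which span \<open>real ^ 'm\<close> by dimension count.\<close>

lemma observe_surj: "observe l ` U = UNIV"
proof -
  obtain B where B: "B \<subseteq> U" "independent B" "U \<subseteq> span B" "card B = dim U"
    using basis_exists[of U] by blast
  have span: "span B = U"
    using B subspace_U by (simp add: span_subspace)
  have "inj_on (observe l) (span B)"
    using inj_on_observe span by simp
  then have "independent (observe l ` B)"
    using B(2) linear_observe by (intro linear_independent_injective_image)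
  moreover have "card (observe l ` B) = CARD('m)"
    using B(4) dimension card_image[OF inj_on_subset[OF inj_on_observe B(1)]]
    by (simp add: n_dim_subspace_def)
  ultimately have "UNIV \<subseteq> span (observe l ` B)"
    by (intro card_ge_dim_independent) auto
  then show ?thesis
    using linear_span_image[OF linear_observe] span by auto
qed

abbreviation I :: "'a \<Rightarrow> 'a" where
  "I \<equiv> interpolant l U"

text \<open>Surjectivity of \<open>observe l\<close> on \<open>U\<close> gives existence and
  injectivity uniqueness, so the \<open>THE\<close> in \<open>interpolant\<close> is
  justified.\<close>

lemma interpolant: "I u \<in> U \<and> (\<forall>m. l m (I u) = l m u)"
proof -
  have "observe l u \<in> observe l ` U"
    using observe_surj by simp
  then obtain v where "v \<in> U" "observe l v = observe l u"
    by auto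
  then have "v \<in> U \<and> (\<forall>m. l m v = l m u)"
    by (simp add: observe_def vec_eq_iff)
  moreover have "w = v" if "w \<in> U \<and> (\<forall>m. l m w = l m u)" for w
    using that calculation by (intro inj_onD[OF inj_on_observe]) (auto simp: observe_def)
  ultimately show ?thesis
    unfolding interpolant_def by (rule theI)
qed

lemma interpolant_in: "I u \<in> U"
  using interpolant by blast

lemma observe_interpolant: "observe l (I u) = observe l u"
  using interpolant by (simp add: observe_def)

lemma interpolant_unique: "v \<in> U \<Longrightarrow> observe l v = observe l u \<Longrightarrow> I u = v"
  using inj_onD[OF inj_on_observe] observe_interpolant interpolant_in by metis

lemma interpolant_id: "v \<in> U \<Longrightarrow> I v = v"
  by (simp add: interpolant_unique)

lemma linear_interpolant: "linear I"
proof (rule linearI)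
  fix u v :: 'a and c :: real
  show "I (u + v) = I u + I v"
    by (intro interpolant_unique)
      (simp_all add: linear_add[OF linear_observe] observe_interpolant interpolant_in
        subspace_add[OF subspace_U])
  show "I (c *\<^sub>R u) = c *\<^sub>R I u"
    by (intro interpolant_unique)
      (simp_all add: linear_scale[OF linear_observe] observe_interpolant interpolant_in
        subspace_scale[OF subspace_U])
qed

section \<open>The modified inner product and its norm\<close>

lemma minner_right: "q \<in> U \<Longrightarrow> minner l U u q = inner (I u) q"
  by (simp add: minner_def interpolant_id)

lemma minner_left: "v \<in> U \<Longrightarrow> minner l U v u = inner v (I u)"
  by (simp add: minner_def interpolant_id)

lemma mnorm_squared: "(mnorm l U u)\<^sup>2 = (norm (u - I u))\<^sup>2 + (norm (I u))\<^sup>2"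
  by (simp add: mnorm_def minner_def power2_norm_eq_inner)

lemma mnorm_eq_norm: "u \<in> U \<Longrightarrow> mnorm l U u = norm u"
  by (simp add: mnorm_def minner_def interpolant_id norm_eq_sqrt_inner)

lemma minner_self_eq_0: "minner l U u u = 0 \<Longrightarrow> u = 0"
  by (auto simp: minner_def add_nonneg_eq_0_iff)

lemma minner_add_left: "minner l U (u + v) w = minner l U u w + minner l U v w"
  by (simp add: minner_def linear_add[OF linear_interpolant] inner_add_left inner_diff_left)

lemma minner_scale_left: "minner l U (c *\<^sub>R u) w = c * minner l U u w"
  by (simp add: minner_def linear_scale[OF linear_interpolant] inner_diff_left right_diff_distrib
      distrib_left)

lemma subspace_morth_complement: "subspace (morth_complement l U W)"
  \<comment> \<open>This instance evaluates \<open>minner\<close> at 0, which puts 0 into the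
    complement.\<close>
  using minner_scale_left[of 0 0]
  by (simp add: subspace_def morth_complement_def minner_add_left minner_scale_left)

section \<open>Reduction from the whole space to \<open>U\<close>\<close>

lemma objective_interpolant:
  "objective (mnorm l U) \<xi> l y (z, \<eta>) = objective norm \<xi> l y (z, I \<eta>) + \<xi> * (norm (\<eta> - I \<eta>))\<^sup>2"
  by (simp add: objective_def mnorm_squared linear_add[OF linear_observe] observe_interpolant
      algebra_simps)

lemma objective_norm_eq:
  "\<eta> \<in> U \<Longrightarrow> objective (mnorm l U) \<xi> l y (z, \<eta>) = objective norm \<xi> l y (z, \<eta>)"
  by (simp add: objective_def mnorm_eq_norm)

lemma arg_min_iff:
  assumes "\<xi> > 0"
  shows "is_arg_min (objective (mnorm l U) \<xi> l y) (\<lambda>p. p \<in> Z \<times> UNIV) p \<longleftrightarrow>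
    is_arg_min (objective norm \<xi> l y) (\<lambda>p. p \<in> Z \<times> U) p" (is "?X \<longleftrightarrow> ?U")
proof
  obtain z \<eta> where p: "p = (z, \<eta>)" by fastforce
  assume X: ?X
  then have "z \<in> Z" by (simp add: is_arg_min_def p)
  have min: "objective (mnorm l U) \<xi> l y (z, \<eta>) \<le> objective norm \<xi> l y (z', \<eta>')"
    if "z' \<in> Z" "\<eta>' \<in> U" for z' \<eta>'
    using X that objective_norm_eq[of \<eta>' \<xi> y z'] unfolding is_arg_min_def p
    by (metis UNIV_I mem_Sigma_iff not_less)
  \<comment> \<open>Compare with the competitor \<open>(z, I \<eta>)\<close>: by
    \<open>objective_interpolant\<close> its value cancels and only the surplus remains.\<close>
  have "\<xi> * (norm (\<eta> - I \<eta>))\<^sup>2 \<le> 0"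
    using min[OF \<open>z \<in> Z\<close> interpolant_in[of \<eta>]] by (simp add: objective_interpolant)
  then have "\<eta> = I \<eta>"
    using assms by (simp add: mult_le_0_iff)
  then have "\<eta> \<in> U"
    using interpolant_in[of \<eta>] by simp
  then show ?U
    using min \<open>z \<in> Z\<close> by (auto simp: is_arg_min_def p objective_norm_eq not_less)
next
  obtain z \<eta> where p: "p = (z, \<eta>)" by fastforce
  assume ?U
  then have "z \<in> Z" "\<eta> \<in> U" and min: "\<And>z' \<eta>'. z' \<in> Z \<Longrightarrow> \<eta>' \<in> U \<Longrightarrow>
      objective norm \<xi> l y (z, \<eta>) \<le> objective norm \<xi> l y (z', \<eta>')"
    by (auto simp: is_arg_min_def p not_less)
  \<comment> \<open>Every competitor costs at least as much as its interpolated version, against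
    which minimality over \<open>Z \<times> U\<close> applies.\<close>
  have "objective (mnorm l U) \<xi> l y (z, \<eta>) \<le> objective (mnorm l U) \<xi> l y (z', \<eta>')"
    if "z' \<in> Z" for z' \<eta>'
    unfolding objective_norm_eq[OF \<open>\<eta> \<in> U\<close>] objective_interpolant[of \<xi> y z' \<eta>']
    using min[OF that interpolant_in[of \<eta>']] assms by (simp add: add_increasing2)
  with \<open>z \<in> Z\<close> show ?X
    by (auto simp: is_arg_min_def p not_less)
qed

text \<open>If \<open>I z = 0\<close>, then \<open>((z, q)) = (I z, q) = 0\<close> for all
  \<open>q\<close> in \<open>U\<close>, so a nonzero such \<open>z\<close> would make the supremum,
  and with it the constant, at most 0.\<close>

lemma inf_sup_injective:
  assumes "inf_sup_const l U Z > 0" "z \<in> Z" "I z = 0"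
  shows "z = 0"
proof (rule ccontr)
  assume "z \<noteq> 0"
  then have "inf_sup_const l U Z \<le>
      (SUP q \<in> U - {0}. ereal (minner l U z q / (mnorm l U z * mnorm l U q)))"
    unfolding inf_sup_const_def using assms(2) by (intro INF_lower) auto
  also have "\<dots> \<le> 0"
    by (rule SUP_least) (simp add: minner_right assms(3))
  finally show False
    using assms(1) by simp
qed

section \<open>The penalised problem as a least squares problem\<close>

context
  fixes Z :: "'a set" and N :: nat and y :: "real ^ 'm" and \<xi> :: real
  assumes Z: "n_dim_subspace N Z" and \<xi>: "\<xi> > 0"
begin

text \<open>The square roots of the weights turn the functional into one squared norm on the product
  space, hence into ordinary linear least squares.\<close>

definition residual :: "'a \<times> 'a \<Rightarrow> 'a \<times> (real ^ 'm)" where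
  "residual = (\<lambda>(z, \<eta>). (sqrt \<xi> *\<^sub>R \<eta>, (1 / sqrt (real CARD('m))) *\<^sub>R observe l (z + \<eta>)))"

definition target :: "'a \<times> (real ^ 'm)" where
  "target = (0, (1 / sqrt (real CARD('m))) *\<^sub>R y)"

lemma linear_residual: "linear residual"
  by (rule linearI)
    (auto simp: residual_def linear_add[OF linear_observe] linear_scale[OF linear_observe]
      algebra_simps)

text \<open>This is half the derivative of the functional at \<open>(z, \<eta>)\<close> in direction
  \<open>(p, q)\<close>.\<close>

lemma inner_residual:
  "inner (residual (z, \<eta>) - target) (residual (p, q)) =
     \<xi> * inner \<eta> q + 1 / real CARD('m) * (\<Sum>m\<in>UNIV. (l m (z + \<eta>) - y $ m) * l m (p + q))"
proof -
  have "residual (z, \<eta>) - target =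
      (sqrt \<xi> *\<^sub>R \<eta>, (1 / sqrt (real CARD('m))) *\<^sub>R (observe l (z + \<eta>) - y))"
    by (simp add: residual_def target_def scaleR_diff_right)
  then show ?thesis
    using \<xi> by (simp add: residual_def inner_vec_def[of "_ - _"] observe_def mult.assoc[symmetric])
qed

lemma objective_eq_residual:
  "objective norm \<xi> l y = (\<lambda>p. (norm (residual p - target))\<^sup>2)"
proof (rule ext, clarify)
  fix z \<eta> :: 'a
  have "residual (z, \<eta>) - target =
      (sqrt \<xi> *\<^sub>R \<eta>, (1 / sqrt (real CARD('m))) *\<^sub>R (observe l (z + \<eta>) - y))"
    by (simp add: residual_def target_def scaleR_diff_right)
  then show "objective norm \<xi> l y (z, \<eta>) = (norm (residual (z, \<eta>) - target))\<^sup>2"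
    using \<xi> by (simp add: objective_def norm_Pair power_mult_distrib power_divide)
qed

lemma product_spanned: obtains B where "finite B" "Z \<times> U = span B"
proof -
  obtain B C where "finite B" "span B = Z" "finite C" "span C = U"
    using Z dimension unfolding n_dim_subspace_def by blast
  then show thesis
    using that[of "(\<lambda>x. (x, 0)) ` B \<union> Pair 0 ` C"] Times_eq_span[of B C] by auto
qed

section \<open>Existence, saddle-point equations and uniqueness\<close>

lemma arg_min_exists:
  obtains z \<eta> where "is_arg_min (objective norm \<xi> l y) (\<lambda>p. p \<in> Z \<times> U) (z, \<eta>)"
proof -
  obtain B where B: "finite B" "Z \<times> U = span B" by (rule product_spanned)
  obtain x where "x \<in> span B" "\<And>v. v \<in> span B \<Longrightarrow> inner (residual x - target) (residual v) = 0"
    using normal_equations_solvable[OF linear_residual B(1)] by blast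
  then have "is_arg_min (objective norm \<xi> l y) (\<lambda>p. p \<in> Z \<times> U) x"
    unfolding objective_eq_residual B(2)
      least_squares_iff_normal_equations[OF linear_residual B(1)] by blast
  then show thesis
    using that by (metis surj_pair)
qed

lemma arg_min_normal_equations:
  assumes "is_arg_min (objective norm \<xi> l y) (\<lambda>p. p \<in> Z \<times> U) (z, \<eta>)" "p \<in> Z" "q \<in> U"
  shows "\<xi> * inner \<eta> q
    + 1 / real CARD('m) * (\<Sum>m\<in>UNIV. (l m (z + \<eta>) - y $ m) * l m (p + q)) = 0"
proof -
  obtain B where B: "finite B" "Z \<times> U = span B" by (rule product_spanned)
  have "\<forall>v\<in>Z \<times> U. inner (residual (z, \<eta>) - target) (residual v) = 0"
    using assms(1) unfolding objective_eq_residual B(2)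
      least_squares_iff_normal_equations[OF linear_residual B(1)] by blast
  then show ?thesis
    using assms(2,3) inner_residual by auto
qed

lemma arg_min_saddle_point:
  assumes min: "is_arg_min (objective norm \<xi> l y) (\<lambda>p. p \<in> Z \<times> U) (z, \<eta>)"
  shows "saddle_point \<xi> l y Z U z \<eta>"
proof -
  have zero: "0 \<in> Z" "0 \<in> U"
    using Z subspace_U by (auto simp: n_dim_subspace_def subspace_0)
  have mem: "z \<in> Z" "\<eta> \<in> U"
    using min by (auto simp: is_arg_min_def)
  \<comment> \<open>Twice the normal equation in direction \<open>(0, q)\<close>; on
    \<open>U\<close> both inner products agree.\<close>
  have "2 * \<xi> * minner l U \<eta> q
      + 2 / real CARD('m) * (\<Sum>m\<in>UNIV. (l m (z + \<eta>) - y $ m) * l m q) = 0" if "q \<in> U" for q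
    using arg_min_normal_equations[OF min zero(1) that] that mem
    by (simp add: minner_left interpolant_id field_simps)
  moreover have "minner l U \<eta> p = 0" if "p \<in> Z" for p
    \<comment> \<open>compare the normal equations for \<open>(p, 0)\<close> and \<open>(0, I p)\<close>: both have the same misfit term\<close>
    using arg_min_normal_equations[OF min that zero(2)]
      arg_min_normal_equations[OF min zero(1) interpolant_in[of p]] mem \<xi>
    by (simp add: minner_left interpolant)
  ultimately show ?thesis
    using mem by (simp add: saddle_point_def)
qed

lemma arg_min_unique:
  assumes pos: "inf_sup_const l U Z > 0"
    and min: "is_arg_min (objective norm \<xi> l y) (\<lambda>p. p \<in> Z \<times> U) (z, \<eta>)"
      "is_arg_min (objective norm \<xi> l y) (\<lambda>p. p \<in> Z \<times> U) (z', \<eta>')"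
  shows "(z, \<eta>) = (z', \<eta>')"
proof -
  obtain B where B: "finite B" "Z \<times> U = span B" by (rule product_spanned)
  have "residual (z, \<eta>) = residual (z', \<eta>')"
    using min unfolding objective_eq_residual B(2)
    by (rule least_squares_unique_image[OF linear_residual B(1)])
  \<comment> \<open>The first component yields \<open>\<eta> = \<eta>'\<close> since \<xi> is
    positive; cancelling it in the second leaves equal observations of \<open>z\<close> and
    \<open>z'\<close>.\<close>
  then have eq: "\<eta> = \<eta>'" "observe l z = observe l z'"
    using \<xi> by (auto simp: residual_def linear_add[OF linear_observe])
  have "z - z' \<in> Z"
    using min Z by (auto simp: is_arg_min_def n_dim_subspace_def subspace_diff)
  moreover have "I (z - z') = 0"
    using eq(2) subspace_0[OF subspace_U]
    by (intro interpolant_unique)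
      (simp_all add: linear_diff[OF linear_observe] linear_0[OF linear_observe])
  ultimately have "z - z' = 0"
    using inf_sup_injective[OF pos] by blast
  with eq show ?thesis by simp
qed

lemma direct_sum_morth_complement:
  "is_direct_sum {z + \<eta> | z \<eta>. z \<in> Z \<and> \<eta> \<in> U \<and> (\<forall>q\<in>Z. minner l U \<eta> q = 0)}
     Z (morth_complement l U Z \<inter> U)"
proof -
  have "subspace Z"
    using Z by (simp add: n_dim_subspace_def)
  moreover have "subspace (morth_complement l U Z \<inter> U)"
    by (intro subspace_inter subspace_morth_complement subspace_U)
  \<comment> \<open>A vector of \<open>Z\<close> that is orthogonal to \<open>Z\<close> is
    orthogonal to itself, and \<open>minner\<close> is definite.\<close>
  moreover from calculation have "Z \<inter> (morth_complement l U Z \<inter> U) = {0}"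
    using minner_self_eq_0 by (auto simp: subspace_0 morth_complement_def dest: subspace_0)
  ultimately show ?thesis
    unfolding is_direct_sum_def by (auto simp: morth_complement_def)
qed

end

end

theorem proposition2p1:
  fixes l :: "'m::finite \<Rightarrow> 'a::{real_inner, complete_space} \<Rightarrow> real"
    and Z U :: "'a set" and N :: nat
    and y :: "real ^ 'm" and \<xi> :: real
  assumes "\<And>m. bounded_linear (l m)"
    and "n_dim_subspace N Z"
    and "n_dim_subspace CARD('m) U"
    and "unisolvent l U"
    and "\<xi> > 0"
  shows
    "(\<exists>z \<eta>. is_arg_min (objective norm \<xi> l y) (\<lambda>p. p \<in> Z \<times> U) (z, \<eta>)) \<and>
     (\<forall>z \<eta>. is_arg_min (objective norm \<xi> l y) (\<lambda>p. p \<in> Z \<times> U) (z, \<eta>) \<longrightarrow>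
        is_arg_min (objective (mnorm l U) \<xi> l y) (\<lambda>p. p \<in> Z \<times> UNIV) (z, \<eta>)) \<and>
     (inf_sup_const l U Z > 0 \<longrightarrow>
        (\<exists>!p. is_arg_min (objective (mnorm l U) \<xi> l y) (\<lambda>p. p \<in> Z \<times> UNIV) p) \<and>
        (\<forall>z \<eta>. is_arg_min (objective (mnorm l U) \<xi> l y) (\<lambda>p. p \<in> Z \<times> UNIV) (z, \<eta>) \<longrightarrow>
           saddle_point \<xi> l y Z U z \<eta>)) \<and>
     is_direct_sum {z + \<eta> | z \<eta>. z \<in> Z \<and> \<eta> \<in> U \<and> (\<forall>q\<in>Z. minner l U \<eta> q = 0)}
       Z (morth_complement l U Z \<inter> U) \<and>
     (\<forall>z \<eta>. is_arg_min (objective (mnorm l U) \<xi> l y) (\<lambda>p. p \<in> Z \<times> UNIV) (z, \<eta>) \<longrightarrow>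
        z + \<eta> \<in> {z + \<eta> | z \<eta>. z \<in> Z \<and> \<eta> \<in> U \<and> (\<forall>q\<in>Z. minner l U \<eta> q = 0)})"
proof -
  interpret unisolvent_observations l U
    using assms by (intro unisolvent_observations.intro bounded_linear.linear)
  note data = assms(2,5)
  note arg_min_iff = arg_min_iff[OF assms(5)]
  obtain z0 \<eta>0 where min0: "is_arg_min (objective norm \<xi> l y) (\<lambda>p. p \<in> Z \<times> U) (z0, \<eta>0)"
    using arg_min_exists[OF data] by blast
  have saddle: "saddle_point \<xi> l y Z U z \<eta>"
    if "is_arg_min (objective norm \<xi> l y) (\<lambda>p. p \<in> Z \<times> U) (z, \<eta>)" for z \<eta>
    using arg_min_saddle_point[OF data that] .
  have "\<exists>!p. is_arg_min (objective norm \<xi> l y) (\<lambda>p. p \<in> Z \<times> U) p"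
    if "inf_sup_const l U Z > 0"
    using min0 arg_min_unique[OF data that] by (metis surj_pair)
  moreover have "z + \<eta> \<in> {z + \<eta> | z \<eta>. z \<in> Z \<and> \<eta> \<in> U \<and> (\<forall>q\<in>Z. minner l U \<eta> q = 0)}"
    if "is_arg_min (objective norm \<xi> l y) (\<lambda>p. p \<in> Z \<times> U) (z, \<eta>)" for z \<eta>
    using saddle[OF that] unfolding saddle_point_def by blast
  ultimately show ?thesis
    \<comment> \<open>Rewriting with \<open>arg_min_iff\<close> turns every claim about minimisers
      over \<open>Z \<times> UNIV\<close> into one over \<open>Z \<times> U\<close>.\<close>
    unfolding arg_min_iff using min0 saddle direct_sum_morth_complement[OF data] by blast
qed

end
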